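(* Let $\mathcal{F}$ be an invariant decomposition on a topological space $X$. Then the Morse hyper-graph $\mathcal{G}_{\mathcal{F}}$ of $\mathcal{F}$ exists. That is, if $\mathcal{M}=\{M_\lambda\}_{\lambda\in\Lambda}$ is the set of inverse images under the quotient map $q\colon X\to X/\mathcal{F}$ of the connected components of $q(\mathcal{Q}(\mathcal{F}))\subseteq X/\mathcal{F}$, then the $M_\lambda$ are pairwise disjoint $\hat{\mathcal{F}}$-invariant non-empty subsets and $X\setminus\bigsqcup_{\lambda\in\Lambda}M_\lambda=\bigsqcup_{I\subseteq\Lambda}H_I$ (a disjoint union).
   Context: A decomposition $\mathcal{F}$ of a topological space $(X,\tau)$ is a family of pairwise disjoint non-empty subsets with union $X$; $\mathcal{F}(x)$ is the element containing $x$, $\mathcal{F}(A)=\bigcup_{x\in A}\mathcal{F}(x)$, and $q\colon X\to X/\mathcal{F}$ is the quotient map (quotient topology). $\mathcal{F}$ is invariant if $\mathcal{F}(U)$ is open for every open $U$. The class decomposition $\hat{\mathcal{F}}$ consists of the sets $\hat{L}=\{x\in X\mid\overline{\mathcal{F}(x)}=\overline{L}\}$, $L\in\mathcal{F}$; a set is $\mathcal{F}$-invariant (resp. $\hat{\mathcal{F}}$-invariant) if it is a union of elements of $\mathcal{F}$ (resp. $\hat{\mathcal{F}}$). An element $L$ is closed if $\overline{L}=L$, and proper if $\overline{L}\setminus L$ is closed; $\mathrm{Cl}(\mathcal{F})$, $\mathrm{P}(\mathcal{F})$, $\mathrm{R}(\mathcal{F})$ are the unions of the closed, non-closed proper, and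 non-proper elements, and $\mathcal{R}(\mathcal{F})=\mathrm{Cl}(\mathcal{F})\sqcup\mathrm{R}(\mathcal{F})$. The abstract element $\langle L\rangle$ of $L\in\mathcal{F}$ is the inverse image under $q$ of the connected component containing $L$ of $\{L'\in X/\mathcal{F}\mid\overline{L}\setminus L=\overline{L'}\setminus L'\}$ if $L\subseteq\mathrm{Cl}(\mathcal{F})\sqcup\mathrm{P}(\mathcal{F})$, and of $\{L'\in X/\mathcal{F}\mid\overline{L}=\overline{L'}\}$ if $L\subseteq\mathrm{R}(\mathcal{F})$; $\langle x\rangle=\langle\mathcal{F}(x)\rangle$. A point $x$ is non-maximal if there is $y\in X$ with $\overline{\mathcal{F}(x)}\subsetneq\overline{\mathcal{F}(y)}$. A point $x$ is quasi-recurrent if $\langle x\rangle$ contains a point of $\mathcal{R}(\mathcal{F})$ or a non-maximal point; $\mathcal{Q}(\mathcal{F})$ is the set of quasi-recurrent points. Given a set $\mathcal{M}=\{M_\lambda\}_{\lambda\in\Lambda}$ of pairwise disjoint $\hat{\mathcal{F}}$-invariant non-empty subsets and $I\subseteq\Lambda$, the hyper-edge $H_I$ is the set of $x\in X\setminus\bigsqcup_\lambda M_\lambda$ for which there are disjoint $\hat{\mathcal{F}}$-invariant non-empty subsets $(C_i)_{i\in I}$ of $\overline{\mathcal{F}(x)}\setminus\mathcal{F}(x)$ with $C_i\subseteq M_i$ and $\overline{\mathcal{F}(x)}\setminus\mathcal{F}(x)=\bigsqcup_{i\in I}C_i$. Put $V=\{M_\lambda\mid\lambda\in\Lambda\}$,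 $H=\{\{M_i\}_{i\in I}\mid H_I\ne\emptyset,\ I\subseteq\Lambda\}$. The pair $\mathcal{G}_{\mathcal{M}}=(V,H)$ is the Morse hyper-graph of $\mathcal{M}$ (it "exists") if $X\setminus\bigsqcup_\lambda M_\lambda=\bigsqcup_{I\subseteq\Lambda}H_I$; it is the Morse hyper-graph $\mathcal{G}_{\mathcal{F}}$ of $\mathcal{F}$ when $\mathcal{M}$ is the set of inverse images under $q$ of connected components of $q(\mathcal{Q}(\mathcal{F}))$. *)

theory Defs
  imports "HOL-Analysis.Analysis" "HOL-Library.Disjoint_Sets"
begin

text \<open>
  A decomposition of a space \<open>X\<close> is a family \<open>F\<close> of sets with \<open>partition_on (topspace X) F\<close>.
\<close>

definition decomp_elem :: "'a set set \<Rightarrow> 'a \<Rightarrow> 'a set" where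
  "decomp_elem F x = (THE L. L \<in> F \<and> x \<in> L)"

definition decomp_saturation :: "'a set set \<Rightarrow> 'a set \<Rightarrow> 'a set" where
  "decomp_saturation F A = (\<Union>x\<in>A. decomp_elem F x)"

definition invariant_decomposition :: "'a topology \<Rightarrow> 'a set set \<Rightarrow> bool" where
  "invariant_decomposition X F \<longleftrightarrow>
     partition_on (topspace X) F \<and> (\<forall>U. openin X U \<longrightarrow> openin X (decomp_saturation F U))"

text \<open>
  The points of the quotient space are the elements of \<open>F\<close>, and the quotient map is
  \<open>decomp_elem F\<close>.
\<close>

definition decomp_preimage :: "'a topology \<Rightarrow> 'a set set \<Rightarrow> 'a set set \<Rightarrow> 'a set" where
  "decomp_preimage X F S = {x \<in> topspace X. decomp_elem F x \<in> S}"

definition decomp_quotient :: "'a topology \<Rightarrow> 'a set set \<Rightarrow> 'a set topology" where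
  "decomp_quotient X F = topology (\<lambda>U. U \<subseteq> F \<and> openin X (decomp_preimage X F U))"

lemma openin_decomp_quotient:
  "openin (decomp_quotient X F) U \<longleftrightarrow> U \<subseteq> F \<and> openin X (decomp_preimage X F U)"
proof -
  have Int: "decomp_preimage X F (S \<inter> T) = decomp_preimage X F S \<inter> decomp_preimage X F T" for S T
    by (auto simp: decomp_preimage_def)
  have Un: "decomp_preimage X F (\<Union>K) = (\<Union>S\<in>K. decomp_preimage X F S)" for K
    by (auto simp: decomp_preimage_def)
  have "istopology (\<lambda>U. U \<subseteq> F \<and> openin X (decomp_preimage X F U))"
    unfolding istopology_def
  proof (intro conjI allI impI)
    fix S T
    assume "S \<subseteq> F \<and> openin X (decomp_preimage X F S)" "T \<subseteq> F \<and> openin X (decomp_preimage X F T)"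
    then show "S \<inter> T \<subseteq> F" "openin X (decomp_preimage X F (S \<inter> T))"
      by (auto simp: Int)
  next
    fix K
    assume K: "\<forall>S\<in>K. S \<subseteq> F \<and> openin X (decomp_preimage X F S)"
    then show "\<Union>K \<subseteq> F"
      by blast
    from K show "openin X (decomp_preimage X F (\<Union>K))"
      by (simp add: Un openin_clauses(3))
  qed
  then show ?thesis
    by (simp add: decomp_quotient_def)
qed

lemma decomp_elem_eq:
  assumes "partition_on (topspace X) F" "L \<in> F" "x \<in> L"
  shows "decomp_elem F x = L"
  unfolding decomp_elem_def
proof (rule the_equality)
  show "L \<in> F \<and> x \<in> L" using assms by simp
  show "L' = L" if "L' \<in> F \<and> x \<in> L'" for L'
    using that assms by (auto simp: partition_on_def disjoint_def)
qed

lemma quotient_map_decomp_elem: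
  assumes "partition_on (topspace X) F"
  shows "quotient_map X (decomp_quotient X F) (decomp_elem F)"
proof -
  have mem: "decomp_elem F x \<in> F" if x: "x \<in> topspace X" for x
  proof -
    obtain L where "L \<in> F" "x \<in> L"
      using assms x by (auto simp: partition_on_def)
    then show ?thesis
      using decomp_elem_eq[OF assms] by simp
  qed
  have sur: "L \<in> decomp_elem F ` topspace X" if "L \<in> F" for L
  proof -
    have "L \<noteq> {}"
      using partition_onD3[OF assms] that by blast
    then obtain x where x: "x \<in> L"
      by blast
    then have "x \<in> topspace X"
      using partition_onD1[OF assms] that by blast
    then show ?thesis
      using decomp_elem_eq[OF assms that x] by blast
  qed
  have "decomp_preimage X F F = topspace X"
    using mem by (auto simp: decomp_preimage_def)
  then have "openin (decomp_quotient X F) F"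
    by (simp add: openin_decomp_quotient)
  then have "F \<subseteq> topspace (decomp_quotient X F)"
    by (rule openin_subset)
  moreover have "topspace (decomp_quotient X F) \<subseteq> F"
    using openin_topspace openin_decomp_quotient by blast
  ultimately have top: "topspace (decomp_quotient X F) = F"
    by blast
  show ?thesis
    unfolding quotient_map_def top
  proof (intro conjI allI impI)
    show "decomp_elem F ` topspace X = F"
      using mem sur by blast
    show "openin X {x. x \<in> topspace X \<and> decomp_elem F x \<in> U} = openin (decomp_quotient X F) U"
      if "U \<subseteq> F" for U
      using that by (simp add: openin_decomp_quotient decomp_preimage_def)
  qed
qed

definition class_decomposition :: "'a topology \<Rightarrow> 'a set set \<Rightarrow> 'a set set" where
  "class_decomposition X F =
     {{x \<in> topspace X. X closure_of (decomp_elem F x) = X closure_of L} |L. L \<in> F}"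

definition union_of_elements :: "'a set set \<Rightarrow> 'a set \<Rightarrow> bool" where
  "union_of_elements F A \<longleftrightarrow> (\<exists>G\<subseteq>F. A = \<Union>G)"

definition closed_element :: "'a topology \<Rightarrow> 'a set \<Rightarrow> bool" where
  "closed_element X L \<longleftrightarrow> X closure_of L = L"

definition proper_element :: "'a topology \<Rightarrow> 'a set \<Rightarrow> bool" where
  "proper_element X L \<longleftrightarrow> closedin X (X closure_of L - L)"

definition Cl_points :: "'a topology \<Rightarrow> 'a set set \<Rightarrow> 'a set" where
  "Cl_points X F = \<Union>{L \<in> F. closed_element X L}"

definition P_points :: "'a topology \<Rightarrow> 'a set set \<Rightarrow> 'a set" where
  "P_points X F = \<Union>{L \<in> F. \<not> closed_element X L \<and> proper_element X L}"

definition R_points :: "'a topology \<Rightarrow> 'a set set \<Rightarrow> 'a set" where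
  "R_points X F = \<Union>{L \<in> F. \<not> proper_element X L}"

definition recurrent_points :: "'a topology \<Rightarrow> 'a set set \<Rightarrow> 'a set" where
  "recurrent_points X F = Cl_points X F \<union> R_points X F"

definition abstract_element :: "'a topology \<Rightarrow> 'a set set \<Rightarrow> 'a set \<Rightarrow> 'a set" where
  "abstract_element X F L =
     decomp_preimage X F
       (connected_component_of_set
         (subtopology (decomp_quotient X F)
           (if L \<subseteq> Cl_points X F \<union> P_points X F
            then {L' \<in> F. X closure_of L - L = X closure_of L' - L'}
            else {L' \<in> F. X closure_of L = X closure_of L'})) L)"

definition non_maximal_point :: "'a topology \<Rightarrow> 'a set set \<Rightarrow> 'a \<Rightarrow> bool" where
  "non_maximal_point X F x \<longleftrightarrow>
     x \<in> topspace X \<and>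
     (\<exists>y \<in> topspace X. X closure_of (decomp_elem F x) \<subset> X closure_of (decomp_elem F y))"

definition quasi_recurrent_points :: "'a topology \<Rightarrow> 'a set set \<Rightarrow> 'a set" where
  "quasi_recurrent_points X F =
     {x \<in> topspace X. \<exists>y \<in> abstract_element X F (decomp_elem F x).
        y \<in> recurrent_points X F \<or> non_maximal_point X F y}"

text \<open>
  A family \<open>(M\<^sub>i)\<close> with index set \<open>\<Lambda>\<close> is a pair \<open>\<Lambda> M\<close>; only the values of \<open>M\<close> on
  \<open>\<Lambda>\<close> matter.
\<close>

definition morse_family :: "'a topology \<Rightarrow> 'a set set \<Rightarrow> 'i set \<Rightarrow> ('i \<Rightarrow> 'a set) \<Rightarrow> bool" where
  "morse_family X F \<Lambda> M \<longleftrightarrow>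
     disjoint_family_on M \<Lambda> \<and>
     (\<forall>i\<in>\<Lambda>. M i \<noteq> {} \<and> M i \<subseteq> topspace X \<and> union_of_elements (class_decomposition X F) (M i))"

definition hyper_edge ::
    "'a topology \<Rightarrow> 'a set set \<Rightarrow> 'i set \<Rightarrow> ('i \<Rightarrow> 'a set) \<Rightarrow> 'i set \<Rightarrow> 'a set" where
  "hyper_edge X F \<Lambda> M I =
     {x \<in> topspace X - (\<Union>i\<in>\<Lambda>. M i).
        \<exists>C. disjoint_family_on C I \<and>
            (\<forall>i\<in>I. C i \<noteq> {} \<and> union_of_elements (class_decomposition X F) (C i) \<and> C i \<subseteq> M i) \<and>
            X closure_of (decomp_elem F x) - decomp_elem F x = (\<Union>i\<in>I. C i)}"

definition morse_hypergraph ::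
    "'a topology \<Rightarrow> 'a set set \<Rightarrow> 'i set \<Rightarrow> ('i \<Rightarrow> 'a set) \<Rightarrow> 'a set set \<times> 'a set set set" where
  "morse_hypergraph X F \<Lambda> M = (M ` \<Lambda>, {M ` I |I. I \<subseteq> \<Lambda> \<and> hyper_edge X F \<Lambda> M I \<noteq> {}})"

definition is_morse_hypergraph ::
    "'a topology \<Rightarrow> 'a set set \<Rightarrow> 'i set \<Rightarrow> ('i \<Rightarrow> 'a set) \<Rightarrow>
     'a set set \<times> 'a set set set \<Rightarrow> bool" where
  "is_morse_hypergraph X F \<Lambda> M G \<longleftrightarrow>
     morse_family X F \<Lambda> M \<and>
     topspace X - (\<Union>i\<in>\<Lambda>. M i) = (\<Union>I\<in>Pow \<Lambda>. hyper_edge X F \<Lambda> M I) \<and>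
     disjoint_family_on (hyper_edge X F \<Lambda> M) (Pow \<Lambda>) \<and>
     G = morse_hypergraph X F \<Lambda> M"

definition morse_sets :: "'a topology \<Rightarrow> 'a set set \<Rightarrow> 'a set set" where
  "morse_sets X F =
     decomp_preimage X F `
       connected_components_of
         (subtopology (decomp_quotient X F) (decomp_elem F ` quasi_recurrent_points X F))"

end

theory Submission
  imports Defs
begin

text \<open>
  Write \<open>\<partial>L\<close> for \<open>closure L - L\<close>, the frontier of the element \<open>L\<close>.
  The hyper-edges exhaust the complement of the Morse sets, whose
  union is the set of quasi-recurrent points, because \<open>\<partial>L\<close> consists of quasi-recurrent points for
  every element \<open>L\<close> outside that set. Indeed, since \<open>L\<close> contains no recurrent point, it is proper,
  so \<open>\<partial>L\<close> is closed. Invariance makes \<open>closure L\<close>, and hence \<open>\<partial>L\<close>, a union of elements.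
  Therefore an element \<open>L'\<close> inside \<open>\<partial>L\<close> has its whole closure inside \<open>\<partial>L\<close>. As this closure misses
  \<open>L\<close>, it is strictly smaller than \<open>closure L\<close>: the points of \<open>L'\<close> are non-maximal, and thus
  quasi-recurrent (\<open>frontier_quasi_recurrent\<close>). Cutting \<open>\<partial>L\<close> by the Morse sets
  gives the pieces \<open>C\<^sub>i\<close> of a hyper-edge (\<open>hyper_edges_cover\<close>), and a point determines its
  hyper-edge because \<open>I\<close> must consist of the indices of the Morse sets that meet \<open>\<partial>L\<close>
  (\<open>hyper_edge_index_set\<close>).

  That the Morse sets are unions of classes rests on two observations. Distinct elements with equal
  closures are non-proper, so all their points are quasi-recurrent. They are also topologically
  indistinguishable in the quotient space, so no connected component separates them
  (\<open>morse_set_class_invariant\<close>).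
\<close>

section \<open>Elements and their closures\<close>

lemma decomp_elem_in:
  assumes "partition_on (topspace X) F" "x \<in> topspace X"
  shows "decomp_elem F x \<in> F" and "x \<in> decomp_elem F x"
proof -
  obtain L where "L \<in> F" "x \<in> L"
    using assms by (auto simp: partition_on_def)
  then show "decomp_elem F x \<in> F" "x \<in> decomp_elem F x"
    using decomp_elem_eq[OF assms(1)] by auto
qed

lemma element_subset_topspace:
  assumes "partition_on (topspace X) F" "L \<in> F"
  shows "L \<subseteq> topspace X"
  using assms by (auto simp: partition_on_def)

lemma element_nonempty:
  assumes "partition_on (topspace X) F" "L \<in> F"
  shows "L \<noteq> {}"
  using assms by (auto simp: partition_on_def)

lemma topspace_decomp_quotient:
  assumes "partition_on (topspace X) F"
  shows "topspace (decomp_quotient X F) = F"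
proof -
  have "decomp_preimage X F F = topspace X"
    using decomp_elem_in(1)[OF assms] by (auto simp: decomp_preimage_def)
  then have "openin (decomp_quotient X F) F"
    by (simp add: openin_decomp_quotient)
  then show ?thesis
    using openin_decomp_quotient[of X F "topspace (decomp_quotient X F)"]
      openin_subset by (metis openin_topspace subset_antisym)
qed

lemma in_closure_of_own_element:
  assumes "partition_on (topspace X) F" "x \<in> topspace X"
  shows "x \<in> X closure_of (decomp_elem F x)"
  using closure_of_subset[OF element_subset_topspace[OF assms(1) decomp_elem_in(1)[OF assms]]]
    decomp_elem_in(2)[OF assms] by blast

text \<open>
  Invariance makes the largest open set disjoint from \<open>L\<close> saturated, so its complement, the
  closure of \<open>L\<close>, is saturated as well.
\<close>

lemma closure_of_element_saturated:
  assumes inv: "invariant_decomposition X F" and "L \<in> F" and y: "y \<in> X closure_of L"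
  shows "decomp_elem F y \<subseteq> X closure_of L"
proof
  have part: "partition_on (topspace X) F"
    using inv by (simp add: invariant_decomposition_def)
  have yX: "y \<in> topspace X"
    using y by (rule in_closure_of[THEN iffD1, THEN conjunct1])
  fix z
  assume z: "z \<in> decomp_elem F y"
  then have zX: "z \<in> topspace X"
    using element_subset_topspace[OF part decomp_elem_in(1)[OF part yX]] by blast
  have zy: "decomp_elem F z = decomp_elem F y"
    using decomp_elem_eq[OF part decomp_elem_in(1)[OF part yX] z] .
  show "z \<in> X closure_of L"
    unfolding in_closure_of
  proof (intro conjI allI impI)
    fix U
    assume U: "z \<in> U \<and> openin X U"
    then have "openin X (decomp_saturation F U)"
      using inv by (simp add: invariant_decomposition_def)
    moreover have "y \<in> decomp_saturation F U"
      using U zy decomp_elem_in(2)[OF part yX] by (auto simp: decomp_saturation_def)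
    ultimately obtain w where w: "w \<in> L" "w \<in> decomp_saturation F U"
      using y by (auto simp: in_closure_of)
    then obtain u where u: "u \<in> U" "w \<in> decomp_elem F u"
      by (auto simp: decomp_saturation_def)
    have uX: "u \<in> topspace X"
      using U u(1) openin_subset by blast
    have "decomp_elem F u = L"
      using decomp_elem_eq[OF part decomp_elem_in(1)[OF part uX] u(2)]
        decomp_elem_eq[OF part \<open>L \<in> F\<close> w(1)] by simp
    then have "u \<in> L"
      using decomp_elem_in(2)[OF part uX] by simp
    then show "\<exists>y. y \<in> L \<and> y \<in> U"
      using u(1) by blast
  qed (rule zX)
qed

text \<open>
  The element of \<open>y\<close> lies in the frontier because the closure of \<open>L\<close> is saturated and distinct
  elements are disjoint; properness makes the frontier closed, so it contains the closure as well.
\<close>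

lemma closure_in_frontier_of_proper_element:
  assumes inv: "invariant_decomposition X F" and L: "L \<in> F" "proper_element X L"
    and y: "y \<in> X closure_of L - L"
  shows "X closure_of (decomp_elem F y) \<subseteq> X closure_of L - L"
proof -
  have part: "partition_on (topspace X) F"
    using inv by (simp add: invariant_decomposition_def)
  have yX: "y \<in> topspace X"
    using y by (auto simp: in_closure_of)
  have "z \<notin> L" if "z \<in> decomp_elem F y" for z
  proof
    assume "z \<in> L"
    then have "decomp_elem F y = L"
      using decomp_elem_eq[OF part L(1), of z]
        decomp_elem_eq[OF part decomp_elem_in(1)[OF part yX] that] by simp
    then show False
      using y decomp_elem_in(2)[OF part yX] by simp
  qed
  then have "decomp_elem F y \<subseteq> X closure_of L - L"
    using closure_of_element_saturated[OF inv L(1)] y by blast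
  then show ?thesis
    using L(2) by (simp add: proper_element_def closure_of_minimal)
qed

section \<open>Unions of classes\<close>

text \<open>
  A pointwise form of being a union of classes, which passes to intersections without any choice
  of the classes involved.
\<close>

definition class_invariant :: "'a topology \<Rightarrow> 'a set set \<Rightarrow> 'a set \<Rightarrow> bool" where
  "class_invariant X F A \<longleftrightarrow>
     A \<subseteq> topspace X \<and>
     (\<forall>x\<in>A. \<forall>y\<in>topspace X.
        X closure_of (decomp_elem F x) = X closure_of (decomp_elem F y) \<longrightarrow> y \<in> A)"

lemma union_of_classes_if_class_invariant:
  assumes part: "partition_on (topspace X) F" and A: "class_invariant X F A"
  shows "union_of_elements (class_decomposition X F) A"
proof -
  define cls where "cls x =
    {y \<in> topspace X. X closure_of (decomp_elem F y) = X closure_of (decomp_elem F x)}" for x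
  have "cls ` A \<subseteq> class_decomposition X F"
    using A decomp_elem_in(1)[OF part]
    by (fastforce simp: class_decomposition_def class_invariant_def cls_def)
  moreover have "A = \<Union>(cls ` A)"
  proof
    show "A \<subseteq> \<Union>(cls ` A)"
      using A by (auto simp: class_invariant_def cls_def)
    show "\<Union>(cls ` A) \<subseteq> A"
    proof
      fix y
      assume "y \<in> \<Union>(cls ` A)"
      then obtain x where "x \<in> A" "y \<in> topspace X"
        "X closure_of (decomp_elem F x) = X closure_of (decomp_elem F y)"
        by (auto simp: cls_def)
      then show "y \<in> A"
        using A unfolding class_invariant_def by blast
    qed
  qed
  ultimately show ?thesis
    unfolding union_of_elements_def by blast
qed

lemma class_invariant_Int:
  assumes "class_invariant X F A" "class_invariant X F B"
  shows "class_invariant X F (A \<inter> B)"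
  using assms unfolding class_invariant_def by blast

text \<open>
  A point with the same element closure as some point \<open>y\<close> lies in the closure of the element of \<open>y\<close>,
  and this closure stays in the frontier.
\<close>

lemma class_invariant_frontier_of_proper_element:
  assumes inv: "invariant_decomposition X F" and L: "L \<in> F" "proper_element X L"
  shows "class_invariant X F (X closure_of L - L)"
  unfolding class_invariant_def
proof (intro conjI ballI impI)
  have part: "partition_on (topspace X) F"
    using inv by (simp add: invariant_decomposition_def)
  show "X closure_of L - L \<subseteq> topspace X"
    using closure_of_subset_topspace by fastforce
  fix y z
  assume y: "y \<in> X closure_of L - L" and z: "z \<in> topspace X"
    and eq: "X closure_of (decomp_elem F y) = X closure_of (decomp_elem F z)"
  have "z \<in> X closure_of (decomp_elem F z)"
    using in_closure_of_own_element[OF part z] .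
  then show "z \<in> X closure_of L - L"
    using closure_in_frontier_of_proper_element[OF inv L y] eq by blast
qed

text \<open>
  A second element with the same closure as \<open>L\<close> would lie in the frontier of \<open>L\<close>; when \<open>L\<close> is
  proper, the closure of that second element then misses \<open>L\<close>, although it contains \<open>L\<close>.
\<close>

lemma proper_element_determined_by_closure:
  assumes inv: "invariant_decomposition X F"
    and x: "x \<in> topspace X" "proper_element X (decomp_elem F x)"
    and y: "y \<in> topspace X"
    and eq: "X closure_of (decomp_elem F x) = X closure_of (decomp_elem F y)"
  shows "decomp_elem F x = decomp_elem F y"
proof (rule ccontr)
  have part: "partition_on (topspace X) F"
    using inv by (simp add: invariant_decomposition_def)
  note Lx = decomp_elem_in[OF part x(1)]
  assume "decomp_elem F x \<noteq> decomp_elem F y"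
  then have "y \<notin> decomp_elem F x"
    using decomp_elem_eq[OF part Lx(1), of y] by blast
  moreover have "y \<in> X closure_of (decomp_elem F x)"
    using in_closure_of_own_element[OF part y] eq by simp
  ultimately have "X closure_of (decomp_elem F x) \<subseteq> X closure_of (decomp_elem F x) - decomp_elem F x"
    using closure_in_frontier_of_proper_element[OF inv Lx(1) x(2), of y] eq by simp
  moreover have "x \<in> X closure_of (decomp_elem F x)"
    using in_closure_of_own_element[OF part x(1)] .
  ultimately show False
    using Lx(2) by blast
qed

section \<open>Quasi-recurrent points and Morse sets\<close>

text \<open>
  Since \<open>L\<close> satisfies both conditions that define its abstract element, it belongs to its own
  connected component there.
\<close>

lemma element_subset_abstract_element:
  assumes part: "partition_on (topspace X) F" and L: "L \<in> F"
  shows "L \<subseteq> abstract_element X F L"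
proof
  fix x
  assume x: "x \<in> L"
  have "decomp_elem F x = L"
    using decomp_elem_eq[OF part L x] .
  then show "x \<in> abstract_element X F L"
    using x L element_subset_topspace[OF part L]
    by (auto simp: abstract_element_def decomp_preimage_def connected_component_of_refl
        topspace_decomp_quotient[OF part])
qed

lemma nonproper_or_nonmaximal_imp_quasi_recurrent:
  assumes part: "partition_on (topspace X) F" and x: "x \<in> topspace X"
    and "\<not> proper_element X (decomp_elem F x) \<or> non_maximal_point X F x"
  shows "x \<in> quasi_recurrent_points X F"
proof -
  note Lx = decomp_elem_in[OF part x]
  have "x \<in> recurrent_points X F \<or> non_maximal_point X F x"
    using assms(3) Lx by (auto simp: recurrent_points_def R_points_def)
  moreover have "x \<in> abstract_element X F (decomp_elem F x)"
    using element_subset_abstract_element[OF part Lx(1)] Lx(2) by blast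
  ultimately show ?thesis
    using x by (auto simp: quasi_recurrent_points_def)
qed

lemma frontier_quasi_recurrent:
  assumes inv: "invariant_decomposition X F" and L: "L \<in> F" "proper_element X L"
  shows "X closure_of L - L \<subseteq> quasi_recurrent_points X F"
proof
  have part: "partition_on (topspace X) F"
    using inv by (simp add: invariant_decomposition_def)
  fix y
  assume y: "y \<in> X closure_of L - L"
  then have yX: "y \<in> topspace X"
    by (auto simp: in_closure_of)
  obtain x where x: "x \<in> L"
    using element_nonempty[OF part L(1)] by blast
  have xX: "x \<in> topspace X" and sub: "L \<subseteq> X closure_of L"
    using x element_subset_topspace[OF part L(1)] closure_of_subset by auto
  have "X closure_of (decomp_elem F y) \<subset> X closure_of (decomp_elem F x)"
    using closure_in_frontier_of_proper_element[OF inv L y] x sub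
    by (auto simp: decomp_elem_eq[OF part L(1) x])
  then have "non_maximal_point X F y"
    using xX yX by (auto simp: non_maximal_point_def)
  then show "y \<in> quasi_recurrent_points X F"
    using nonproper_or_nonmaximal_imp_quasi_recurrent[OF part yX] by blast
qed

lemma decomp_elem_image_quasi_recurrent_iff:
  assumes "x \<in> topspace X"
  shows "decomp_elem F x \<in> decomp_elem F ` quasi_recurrent_points X F \<longleftrightarrow>
    x \<in> quasi_recurrent_points X F"
  using assms by (auto simp: quasi_recurrent_points_def)

lemma topspace_quasi_recurrent_quotient:
  assumes part: "partition_on (topspace X) F"
  shows "topspace (subtopology (decomp_quotient X F) (decomp_elem F ` quasi_recurrent_points X F)) =
    decomp_elem F ` quasi_recurrent_points X F"
  using decomp_elem_in(1)[OF part]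
  by (auto simp: topspace_decomp_quotient[OF part] quasi_recurrent_points_def)

lemma Union_morse_sets:
  assumes part: "partition_on (topspace X) F"
  shows "\<Union>(morse_sets X F) = quasi_recurrent_points X F"
proof -
  have "\<Union>(morse_sets X F) = decomp_preimage X F (\<Union>(connected_components_of
      (subtopology (decomp_quotient X F) (decomp_elem F ` quasi_recurrent_points X F))))"
    by (auto simp: morse_sets_def decomp_preimage_def)
  also have "\<dots> = decomp_preimage X F (decomp_elem F ` quasi_recurrent_points X F)"
    by (simp only: Union_connected_components_of topspace_quasi_recurrent_quotient[OF part])
  also have "\<dots> = quasi_recurrent_points X F"
    using decomp_elem_image_quasi_recurrent_iff[of _ X F]
    by (auto simp: decomp_preimage_def quasi_recurrent_points_def)
  finally show ?thesis .
qed

lemma morse_set_nonempty: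
  assumes part: "partition_on (topspace X) F" and "A \<in> morse_sets X F"
  shows "A \<noteq> {}"
proof -
  let ?Y = "subtopology (decomp_quotient X F) (decomp_elem F ` quasi_recurrent_points X F)"
  obtain K where K: "K \<in> connected_components_of ?Y" "A = decomp_preimage X F K"
    using assms(2) by (auto simp: morse_sets_def)
  obtain L where "L \<in> K"
    using nonempty_connected_components_of[OF K(1)] by blast
  moreover have "K \<subseteq> decomp_elem F ` quasi_recurrent_points X F"
    using connected_components_of_subset[OF K(1)]
    unfolding topspace_quasi_recurrent_quotient[OF part] .
  ultimately show ?thesis
    by (auto simp: K(2) decomp_preimage_def quasi_recurrent_points_def)
qed

lemma morse_sets_disjoint:
  assumes "A \<in> morse_sets X F" "B \<in> morse_sets X F" "A \<noteq> B"
  shows "A \<inter> B = {}"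
proof -
  let ?Y = "subtopology (decomp_quotient X F) (decomp_elem F ` quasi_recurrent_points X F)"
  obtain K K' where K: "K \<in> connected_components_of ?Y" "A = decomp_preimage X F K"
    and K': "K' \<in> connected_components_of ?Y" "B = decomp_preimage X F K'"
    using assms(1,2) by (auto simp: morse_sets_def)
  have "disjnt K K'"
    using pairwise_disjoint_connected_components_of[of ?Y] K K' assms(3)
    by (auto simp: pairwise_def)
  then show ?thesis
    by (auto simp: K(2) K'(2) decomp_preimage_def disjnt_def)
qed

text \<open>
  Let \<open>x\<close> and \<open>y\<close> have equal element closures. If their elements coincide, nothing is to be shown.
  Otherwise the element of \<open>y\<close> is non-proper, so that \<open>y\<close> is quasi-recurrent. By continuity of the
  quotient map, the element of \<open>y\<close> is in the quotient a point of the closure of the singleton of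
  the element of \<open>x\<close>; adding it to this singleton gives a connected set.
\<close>

lemma morse_set_class_invariant:
  assumes inv: "invariant_decomposition X F" and A: "A \<in> morse_sets X F"
  shows "class_invariant X F A"
  unfolding class_invariant_def
proof (intro conjI ballI impI)
  have part: "partition_on (topspace X) F"
    using inv by (simp add: invariant_decomposition_def)
  let ?q = "decomp_elem F" and ?Q = "quasi_recurrent_points X F"
  define Y where "Y = subtopology (decomp_quotient X F) (?q ` ?Q)"
  obtain K where K: "K \<in> connected_components_of Y" and AK: "A = decomp_preimage X F K"
    using A by (auto simp: morse_sets_def Y_def)
  show "A \<subseteq> topspace X"
    by (auto simp: AK decomp_preimage_def)
  fix x y
  assume xA: "x \<in> A" and y: "y \<in> topspace X"
    and eq: "X closure_of (?q x) = X closure_of (?q y)"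
  have x: "x \<in> topspace X" and xK: "?q x \<in> K"
    using xA by (auto simp: AK decomp_preimage_def)
  have xQ: "x \<in> ?Q"
    using Union_morse_sets[OF part] A xA by blast
  have yQ: "y \<in> ?Q"
  proof (cases "proper_element X (?q y)")
    case True
    then have "?q y = ?q x"
      using proper_element_determined_by_closure[OF inv y True x] eq by simp
    then show ?thesis
      using xQ y by (simp add: quasi_recurrent_points_def)
  qed (use nonproper_or_nonmaximal_imp_quasi_recurrent[OF part y] in blast)
  have top: "topspace Y = ?q ` ?Q"
    unfolding Y_def by (rule topspace_quasi_recurrent_quotient[OF part])
  note Lx = decomp_elem_in[OF part x]
  have "?q z = ?q x" if "z \<in> ?q x" for z
    using decomp_elem_eq[OF part Lx(1) that] .
  then have "?q ` (?q x) = {?q x}"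
    using Lx(2) by blast
  then have "?q ` (X closure_of (?q x)) \<subseteq> decomp_quotient X F closure_of {?q x}"
    using continuous_map_image_closure_subset[OF
        quotient_imp_continuous_map[OF quotient_map_decomp_elem[OF part]]] by metis
  moreover have "y \<in> X closure_of (?q x)"
    using in_closure_of_own_element[OF part y] eq by simp
  ultimately have "?q y \<in> Y closure_of {?q x}"
    using xQ yQ unfolding Y_def closure_of_subtopology by (simp add: image_subset_iff)
  moreover have "?q x \<in> Y closure_of {?q x}"
    using closure_of_subset[of "{?q x}" Y] xQ top by auto
  moreover have "connectedin Y {?q x}"
    using xQ top by (simp add: connectedin_sing)
  ultimately have "connectedin Y {?q x, ?q y}"
    using connectedin_intermediate_closure_of[of Y "{?q x}" "{?q x, ?q y}"] by simp
  then have "{?q x, ?q y} \<subseteq> K"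
    using connected_components_of_maximal[OF K] xK by (auto simp: disjnt_def)
  then show "y \<in> A"
    using y by (simp add: AK decomp_preimage_def)
qed

section \<open>Hyper-edges\<close>

text \<open>
  The pieces \<open>C\<^sub>i\<close> are non-empty, so every index in \<open>I\<close> is seen in the frontier of the element of
  \<open>x\<close>. They exhaust this frontier and the sets \<open>M\<^sub>i\<close> are disjoint, so no other index is seen there.
\<close>

lemma hyper_edge_index_set:
  assumes disj: "disjoint_family_on M \<Lambda>" and I: "I \<subseteq> \<Lambda>" and x: "x \<in> hyper_edge X F \<Lambda> M I"
  shows "I = {i \<in> \<Lambda>. M i \<inter> (X closure_of (decomp_elem F x) - decomp_elem F x) \<noteq> {}}"
    (is "I = {i \<in> \<Lambda>. M i \<inter> ?D \<noteq> {}}")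
proof -
  obtain C where C: "\<And>i. i \<in> I \<Longrightarrow> C i \<noteq> {} \<and> C i \<subseteq> M i" and D: "?D = (\<Union>i\<in>I. C i)"
    using x by (auto simp: hyper_edge_def)
  have "M i \<inter> ?D \<noteq> {}" if "i \<in> I" for i
    using C[OF that] that unfolding D by blast
  moreover have "i \<in> I" if i: "i \<in> \<Lambda>" and ne: "M i \<inter> ?D \<noteq> {}" for i
  proof -
    obtain z j where "z \<in> M i" "j \<in> I" "z \<in> C j"
      using ne unfolding D by blast
    then show ?thesis
      using C[of j] disjoint_family_onD[OF disj i, of j] I by blast
  qed
  ultimately show ?thesis
    using I by blast
qed

lemma hyper_edges_disjoint:
  assumes "disjoint_family_on M \<Lambda>"
  shows "disjoint_family_on (hyper_edge X F \<Lambda> M) (Pow \<Lambda>)"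
  unfolding disjoint_family_on_def
proof (intro ballI impI)
  fix I J
  assume "I \<in> Pow \<Lambda>" "J \<in> Pow \<Lambda>" "I \<noteq> J"
  then have IJ: "I \<subseteq> \<Lambda>" "J \<subseteq> \<Lambda>" "I \<noteq> J"
    by auto
  have False if "x \<in> hyper_edge X F \<Lambda> M I" "x \<in> hyper_edge X F \<Lambda> M J" for x
    using hyper_edge_index_set[OF assms IJ(1) that(1)] hyper_edge_index_set[OF assms IJ(2) that(2)]
      IJ(3) by blast
  then show "hyper_edge X F \<Lambda> M I \<inter> hyper_edge X F \<Lambda> M J = {}"
    by blast
qed

text \<open>
  The traces of the sets \<open>M\<^sub>i\<close> on the frontier of an element are the only candidates for the pieces
  of a hyper-edge; the assumption on frontiers is what makes them exhaust it and be unions of classes.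
\<close>

lemma hyper_edges_cover:
  assumes part: "partition_on (topspace X) F" and disj: "disjoint_family_on M \<Lambda>"
    and M: "\<And>i. i \<in> \<Lambda> \<Longrightarrow> class_invariant X F (M i)"
    and frontier: "\<And>x. x \<in> topspace X - (\<Union>i\<in>\<Lambda>. M i) \<Longrightarrow>
      class_invariant X F (X closure_of (decomp_elem F x) - decomp_elem F x) \<and>
      X closure_of (decomp_elem F x) - decomp_elem F x \<subseteq> (\<Union>i\<in>\<Lambda>. M i)"
  shows "topspace X - (\<Union>i\<in>\<Lambda>. M i) = (\<Union>I\<in>Pow \<Lambda>. hyper_edge X F \<Lambda> M I)"
proof
  show "(\<Union>I\<in>Pow \<Lambda>. hyper_edge X F \<Lambda> M I) \<subseteq> topspace X - (\<Union>i\<in>\<Lambda>. M i)"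
    by (auto simp: hyper_edge_def)
  show "topspace X - (\<Union>i\<in>\<Lambda>. M i) \<subseteq> (\<Union>I\<in>Pow \<Lambda>. hyper_edge X F \<Lambda> M I)"
  proof
    fix x
    assume x: "x \<in> topspace X - (\<Union>i\<in>\<Lambda>. M i)"
    define D where "D = X closure_of (decomp_elem F x) - decomp_elem F x"
    define I where "I = {i \<in> \<Lambda>. M i \<inter> D \<noteq> {}}"
    have D: "class_invariant X F D" "D \<subseteq> (\<Union>i\<in>\<Lambda>. M i)"
      using frontier[OF x] by (auto simp: D_def)
    have "disjoint_family_on (\<lambda>i. M i \<inter> D) I"
      using disj by (auto simp: disjoint_family_on_def I_def)
    moreover have "union_of_elements (class_decomposition X F) (M i \<inter> D)" if "i \<in> I" for i
      using that M D(1)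
      by (intro union_of_classes_if_class_invariant[OF part] class_invariant_Int) (auto simp: I_def)
    moreover have "D = (\<Union>i\<in>I. M i \<inter> D)"
      using D(2) unfolding I_def by blast
    ultimately have "x \<in> hyper_edge X F \<Lambda> M I"
      using x unfolding hyper_edge_def mem_Collect_eq D_def[symmetric]
      by (intro conjI exI[of _ "\<lambda>i. M i \<inter> D"]) (auto simp: I_def)
    then show "x \<in> (\<Union>I\<in>Pow \<Lambda>. hyper_edge X F \<Lambda> M I)"
      by (auto simp: I_def)
  qed
qed

theorem corollary7p8:
  fixes X :: "'a topology"
    and F :: "'a set set"
    and \<Lambda> :: "'i set"
    and M :: "'i \<Rightarrow> 'a set"
  assumes "invariant_decomposition X F"
    and "bij_betw M \<Lambda> (morse_sets X F)"
  shows "(\<exists>G. is_morse_hypergraph X F \<Lambda> M G) \<and>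
         disjoint_family_on M \<Lambda> \<and>
         (\<forall>i\<in>\<Lambda>. M i \<noteq> {} \<and> union_of_elements (class_decomposition X F) (M i)) \<and>
         topspace X - (\<Union>i\<in>\<Lambda>. M i) = (\<Union>I\<in>Pow \<Lambda>. hyper_edge X F \<Lambda> M I) \<and>
         disjoint_family_on (hyper_edge X F \<Lambda> M) (Pow \<Lambda>)"
proof -
  note inv = assms(1)
  have part: "partition_on (topspace X) F"
    using inv by (simp add: invariant_decomposition_def)
  have inj: "inj_on M \<Lambda>" and img: "M ` \<Lambda> = morse_sets X F"
    using assms(2) by (auto simp: bij_betw_def)
  have mem: "M i \<in> morse_sets X F" if "i \<in> \<Lambda>" for i
    using img that by blast
  have disj: "disjoint_family_on M \<Lambda>"
    unfolding disjoint_family_on_def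
    using morse_sets_disjoint[OF mem mem] inj_on_eq_iff[OF inj] by blast
  have sets: "M i \<noteq> {}" "class_invariant X F (M i)" if "i \<in> \<Lambda>" for i
    using morse_set_nonempty[OF part mem[OF that]] morse_set_class_invariant[OF inv mem[OF that]]
    by auto
  have union: "(\<Union>i\<in>\<Lambda>. M i) = quasi_recurrent_points X F"
    using img Union_morse_sets[OF part] by simp
  have cover: "topspace X - (\<Union>i\<in>\<Lambda>. M i) = (\<Union>I\<in>Pow \<Lambda>. hyper_edge X F \<Lambda> M I)"
  proof (rule hyper_edges_cover[OF part disj sets(2)])
    fix x
    assume "x \<in> topspace X - (\<Union>i\<in>\<Lambda>. M i)"
    then have x: "x \<in> topspace X" "x \<notin> quasi_recurrent_points X F"
      by (auto simp: union)
    have L: "decomp_elem F x \<in> F" "proper_element X (decomp_elem F x)"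
      using decomp_elem_in(1)[OF part x(1)]
        nonproper_or_nonmaximal_imp_quasi_recurrent[OF part x(1)] x(2) by auto
    show "class_invariant X F (X closure_of (decomp_elem F x) - decomp_elem F x) \<and>
        X closure_of (decomp_elem F x) - decomp_elem F x \<subseteq> (\<Union>i\<in>\<Lambda>. M i)"
      using class_invariant_frontier_of_proper_element[OF inv L] frontier_quasi_recurrent[OF inv L]
      by (simp add: union)
  qed
  have unions: "\<forall>i\<in>\<Lambda>. M i \<noteq> {} \<and> union_of_elements (class_decomposition X F) (M i)"
    using sets union_of_classes_if_class_invariant[OF part] by blast
  have "morse_family X F \<Lambda> M"
    using disj sets unions by (simp add: morse_family_def class_invariant_def)
  then show ?thesis
    using disj unions cover hyper_edges_disjoint[OF disj] by (auto simp: is_morse_hypergraph_def)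
qed

end
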